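(* There is a constant $C$ such that for every integer $d$ divisible by $4$, every $1$-cover of $\mathtt{Disj}_{d/4,d/4,d}$ has sparsity at least $2^d/\left(d^{C}\binom{d}{d/4}\right)$.
   Context: The disjointness matrix $\mathtt{Disj}_{p,q,d}$ has rows indexed by $\binom{[d]}{p}$, columns indexed by $\binom{[d]}{q}$, and entry $1$ at $(A,B)$ if $A\cap B=\emptyset$ and $0$ otherwise. A monochromatic rectangle is a pair $(X,Y)$ of a set of rows and a set of columns on which all entries are equal. A family $(X_1,Y_1),\ldots,(X_z,Y_z)$ of monochromatic rectangles is a $1$-cover if every $1$-entry lies in some $X_k\times Y_k$. The sparsity of a $1$-cover of an $n\times m$ matrix is $\sum_i|X_i|/n+\sum_i|Y_i|/m$. *)

theory Defs
  imports Complex_Main "HOL-Library.Ramsey"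
begin

record ('r, 'c, 'e) indexed_matrix =
  row_set :: "'r set"
  col_set :: "'c set"
  entry :: "'r \<Rightarrow> 'c \<Rightarrow> 'e"

(* nsets S k is the set of k-element subsets of S *)
definition Disj :: "nat \<Rightarrow> nat \<Rightarrow> nat \<Rightarrow> (nat set, nat set, nat) indexed_matrix" where
  "Disj p q d =
     \<lparr> row_set = nsets {1..d} p,
       col_set = nsets {1..d} q,
       entry = (\<lambda>A B. if A \<inter> B = {} then 1 else 0) \<rparr>"

definition monochromatic_rectangle ::
    "('r, 'c, 'e) indexed_matrix \<Rightarrow> 'r set \<Rightarrow> 'c set \<Rightarrow> bool" where
  "monochromatic_rectangle M X Y \<longleftrightarrow>
     X \<subseteq> row_set M \<and> Y \<subseteq> col_set M \<and>
     (\<exists>c. \<forall>x\<in>X. \<forall>y\<in>Y. entry M x y = c)"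

(* A family is a list, so that a rectangle occurring several times contributes
   to the sparsity with multiplicity. Rectangles with all entries 0, and empty
   rectangles, are not excluded. *)
definition one_cover ::
    "('r, 'c, 'e::one) indexed_matrix \<Rightarrow> ('r set \<times> 'c set) list \<Rightarrow> bool" where
  "one_cover M F \<longleftrightarrow>
     (\<forall>(X, Y) \<in> set F. monochromatic_rectangle M X Y) \<and>
     (\<forall>x \<in> row_set M. \<forall>y \<in> col_set M. entry M x y = 1 \<longrightarrow>
        (\<exists>(X, Y) \<in> set F. x \<in> X \<and> y \<in> Y))"

definition sparsity ::
    "('r, 'c, 'e) indexed_matrix \<Rightarrow> ('r set \<times> 'c set) list \<Rightarrow> real" where
  "sparsity M F =
     (\<Sum>(X, Y) \<leftarrow> F. real (card X)) / real (card (row_set M)) +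
     (\<Sum>(X, Y) \<leftarrow> F. real (card Y)) / real (card (col_set M))"

end

theory Submission
  imports Defs
begin

text \<open>
  A rectangle of 1-entries \<open>X \<times> Y\<close> has disjoint supports \<open>\<Union>X\<close> and \<open>\<Union>Y\<close>, one of which has at
  most \<open>d/2\<close> elements, so with \<open>k = d/4\<close> it contains at most
  \<open>min |X| |Y| * max |X| |Y| \<le> (2k choose k) * (|X| + |Y|)\<close> entries. A 1-cover has to contain all
  \<open>(4k choose k) * (3k choose k)\<close> 1-entries, so its sparsity is at least
  \<open>(3k choose k) / (2k choose k) = (4k choose 2k) / (4k choose k)\<close>, and the central binomial
  coefficient is at least \<open>2^d / d\<close>.
\<close>

definition one_entries :: "('r, 'c, 'e::one) indexed_matrix \<Rightarrow> ('r \<times> 'c) set" where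
  "one_entries M = {(x, y). x \<in> row_set M \<and> y \<in> col_set M \<and> entry M x y = 1}"

lemma card_nsets:
  assumes "finite S"
  shows "card (nsets S k) = card S choose k"
proof -
  have "nsets S k = {A. A \<subseteq> S \<and> card A = k}"
    using assms by (auto simp: nsets_def dest: finite_subset)
  then show ?thesis
    using assms by (simp add: n_subsets)
qed

lemma row_set_Disj [simp]: "row_set (Disj p q d) = nsets {1..d} p"
  and col_set_Disj [simp]: "col_set (Disj p q d) = nsets {1..d} q"
  and entry_Disj [simp]: "entry (Disj p q d) A B = (if A \<inter> B = {} then 1 else 0)"
  by (simp_all add: Disj_def)

text \<open>Choose the row \<open>A\<close> first; the columns disjoint from it are the
  \<open>q\<close>-subsets of its complement, whose size depends only on \<open>p\<close>.\<close>

lemma card_one_entries_Disj: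
  "card (one_entries (Disj p q d)) = (d choose p) * ((d - p) choose q)"
proof -
  have "one_entries (Disj p q d) = (SIGMA A:nsets {1..d} p. nsets ({1..d} - A) q)"
    by (auto simp: one_entries_def nsets_def)
  moreover have "card (nsets ({1..d} - A) q) = (d - p) choose q" if "A \<in> nsets {1..d} p" for A
    using that by (subst card_nsets) (auto simp: nsets_def card_Diff_subset)
  ultimately show ?thesis
    by (simp add: finite_imp_finite_nsets card_nsets)
qed

lemma card_le_choose_of_Union:
  assumes "X \<subseteq> nsets S k" "finite S" "card (\<Union>X) \<le> m"
  shows "card X \<le> m choose k"
proof -
  have fin: "finite (\<Union>X)"
    using assms(1,2) by (auto simp: nsets_def intro: finite_subset[of _ S])
  have "X \<subseteq> nsets (\<Union>X) k"
    using assms(1) by (auto simp: nsets_def)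
  then have "card X \<le> card (\<Union>X) choose k"
    using card_mono[OF finite_imp_finite_nsets[OF fin]] by (simp add: card_nsets fin)
  also have "\<dots> \<le> m choose k"
    using assms(3) by (rule binomial_right_mono)
  finally show ?thesis .
qed

lemma card_one_entries_rectangle_le:
  assumes "monochromatic_rectangle (Disj k k (2 * m)) X Y"
  shows "card (X \<times> Y \<inter> one_entries (Disj k k (2 * m))) \<le> (m choose k) * (card X + card Y)"
proof (cases "X \<times> Y \<inter> one_entries (Disj k k (2 * m)) = {}")
  case False
  have X: "X \<subseteq> nsets {1..2 * m} k" and Y: "Y \<subseteq> nsets {1..2 * m} k"
    using assms by (auto simp: monochromatic_rectangle_def)
  then have fin: "finite X" "finite Y"
    by (auto intro: finite_subset finite_imp_finite_nsets)
  have sub: "\<Union>X \<subseteq> {1..2 * m}" "\<Union>Y \<subseteq> {1..2 * m}"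
    using X Y by (auto simp: nsets_def)
  \<comment> \<open>Rectangles of 0-entries and empty ones fall under the other case. Here one
    disjoint pair forces the constant \<open>c\<close> to be 1, so every row set is disjoint from
    every column set.\<close>
  obtain A B where AB: "A \<in> X" "B \<in> Y" "A \<inter> B = {}"
    using False by (auto simp: one_entries_def split: if_splits)
  obtain c :: nat where "\<forall>A\<in>X. \<forall>B\<in>Y. (if A \<inter> B = {} then 1 else 0) = c"
    using assms by (auto simp: monochromatic_rectangle_def)
  then have "A' \<inter> B' = {}" if "A' \<in> X" "B' \<in> Y" for A' B'
    using AB that by (metis zero_neq_one)
  then have "\<Union>X \<inter> \<Union>Y = {}"
    by auto
  then have "card (\<Union>X) + card (\<Union>Y) = card (\<Union>X \<union> \<Union>Y)"
    using sub by (intro card_Un_disjoint[symmetric]) (auto intro: finite_subset)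
  also have "\<dots> \<le> 2 * m"
    using card_mono[of "{1..2 * m}" "\<Union>X \<union> \<Union>Y"] sub by simp
  finally have "card (\<Union>X) \<le> m \<or> card (\<Union>Y) \<le> m"
    by linarith
  then have "card X \<le> m choose k \<or> card Y \<le> m choose k"
    using card_le_choose_of_Union X Y by blast
  then have "card X * card Y \<le> (m choose k) * card Y \<or> card X * card Y \<le> card X * (m choose k)"
    using mult_le_mono1 mult_le_mono2 by blast
  \<comment> \<open>Either side may be the small one. The sum covers both cases, and it is the
    quantity that sparsity measures.\<close>
  then have "card X * card Y \<le> (m choose k) * (card X + card Y)"
    unfolding distrib_left mult.commute[of "card X" "m choose k"] by linarith
  moreover have "card (X \<times> Y \<inter> one_entries (Disj k k (2 * m))) \<le> card X * card Y"
    using fin card_mono[of "X \<times> Y" "X \<times> Y \<inter> one_entries (Disj k k (2 * m))"]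
    by (simp add: card_cartesian_product)
  ultimately show ?thesis
    by linarith
qed simp

text \<open>A union bound: the 1-entries are the union of their parts in the rectangles of
  \<open>F\<close>. The induction runs over lists \<open>G\<close> with
  \<open>set G \<subseteq> set F\<close>, so that each rectangle met is still known to be
  monochromatic.\<close>

lemma card_one_entries_le_sum_list:
  assumes "one_cover M F"
    and "\<And>X Y. monochromatic_rectangle M X Y \<Longrightarrow> card (X \<times> Y \<inter> one_entries M) \<le> f X Y"
  shows "card (one_entries M) \<le> (\<Sum>(X, Y) \<leftarrow> F. f X Y)"
proof -
  have "card (\<Union>(X, Y) \<in> set G. X \<times> Y \<inter> one_entries M) \<le> (\<Sum>(X, Y) \<leftarrow> G. f X Y)"
    if "set G \<subseteq> set F" for G
    using that
  proof (induction G)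
    case (Cons R G)
    obtain X Y where R: "R = (X, Y)"
      by fastforce
    have "card (X \<times> Y \<inter> one_entries M) \<le> f X Y"
      using assms Cons.prems R by (auto simp: one_cover_def)
    then show ?case
      using Cons card_Un_le[of "X \<times> Y \<inter> one_entries M"
          "\<Union>(X, Y) \<in> set G. X \<times> Y \<inter> one_entries M"]
      by (simp add: R)
  qed simp
  moreover have "one_entries M = (\<Union>(X, Y) \<in> set F. X \<times> Y \<inter> one_entries M)"
    using assms(1) unfolding one_cover_def one_entries_def by blast
  ultimately show ?thesis
    by (metis order_refl)
qed

lemma sparsity_Disj_ge:
  assumes "one_cover (Disj k k (2 * m)) F" "k \<le> m"
  shows "real ((2 * m - k) choose k) / real (m choose k) \<le> sparsity (Disj k k (2 * m)) F"
proof -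
  define N where "N = (2 * m) choose k"
  define b where "b = m choose k"
  have pos: "0 < N" "0 < b"
    using assms(2) by (simp_all add: N_def b_def)
  have sum: "(\<Sum>(X, Y) \<leftarrow> F. b * (card X + card Y)) =
      b * ((\<Sum>(X, Y) \<leftarrow> F. card X) + (\<Sum>(X, Y) \<leftarrow> F. card Y))"
    by (induction F) (auto simp: algebra_simps)
  have cast: "(\<Sum>(X, Y) \<leftarrow> F. real (card X)) = real (\<Sum>(X, Y) \<leftarrow> F. card X)"
    "(\<Sum>(X, Y) \<leftarrow> F. real (card Y)) = real (\<Sum>(X, Y) \<leftarrow> F. card Y)"
    by (induction F) auto
  have "N * ((2 * m - k) choose k) \<le> (\<Sum>(X, Y) \<leftarrow> F. b * (card X + card Y))"
    using card_one_entries_le_sum_list[OF assms(1) card_one_entries_rectangle_le]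
    by (simp add: card_one_entries_Disj N_def b_def)
  then have "real N * real ((2 * m - k) choose k) \<le>
      real b * (real (\<Sum>(X, Y) \<leftarrow> F. card X) + real (\<Sum>(X, Y) \<leftarrow> F. card Y))"
    unfolding sum by (simp flip: of_nat_mult of_nat_add)
  \<comment> \<open>Rows and columns are indexed by the same sets, so both fractions have
    denominator \<open>N\<close>, which then cancels against the factor \<open>N\<close> in the
    number of 1-entries.\<close>
  moreover have "sparsity (Disj k k (2 * m)) F =
      (real (\<Sum>(X, Y) \<leftarrow> F. card X) + real (\<Sum>(X, Y) \<leftarrow> F. card Y)) / real N"
    unfolding sparsity_def cast by (simp add: card_nsets N_def add_divide_distrib)
  ultimately have "real N * real ((2 * m - k) choose k) \<le>
      real N * (real b * sparsity (Disj k k (2 * m)) F)"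
    using pos by simp
  then show ?thesis
    using pos by (simp add: pos_divide_le_eq mult.commute flip: b_def)
qed

text \<open>After cross-multiplication, both sides count the pairs of a \<open>2k\<close>-subset of
  a \<open>4k\<close>-set and a \<open>k\<close>-subset of it, according to which of the two is
  chosen first.\<close>

lemma choose_ratio_eq:
  "real ((3 * k) choose k) / real ((2 * k) choose k) =
    real ((4 * k) choose (2 * k)) / real ((4 * k) choose k)"
proof -
  have "((4 * k) choose (2 * k)) * ((2 * k) choose k) = ((4 * k) choose k) * ((3 * k) choose k)"
    using choose_mult[of k "2 * k" "4 * k"] by simp
  then have "real ((4 * k) choose (2 * k)) * real ((2 * k) choose k) =
      real ((4 * k) choose k) * real ((3 * k) choose k)"
    by (metis of_nat_mult)
  then show ?thesis
    by (simp add: frac_eq_eq mult.commute)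
qed

theorem theorem6:
  "\<exists>C::real. \<forall>d::nat. 4 dvd d \<longrightarrow>
     (\<forall>F. one_cover (Disj (d div 4) (d div 4) d) F \<longrightarrow>
        sparsity (Disj (d div 4) (d div 4) d) F
          \<ge> 2 ^ d / (real d powr C * real (d choose (d div 4))))"
\<comment> \<open>The exponent 1 pays for the factor \<open>d\<close> lost in bounding the central
  binomial coefficient below by \<open>2 ^ d / d\<close>.\<close>
proof (intro exI[of _ 1] allI impI)
  fix d :: nat and F
  assume "4 dvd d" and cover: "one_cover (Disj (d div 4) (d div 4) d) F"
  then obtain k where d: "d = 4 * k"
    by auto
  have sparse: "real ((4 * k) choose (2 * k)) / real ((4 * k) choose k) \<le> sparsity (Disj k k (4 * k)) F"
    using sparsity_Disj_ge[of k "2 * k" F] cover by (simp add: d choose_ratio_eq)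
  show "2 ^ d / (real d powr 1 * real (d choose (d div 4))) \<le> sparsity (Disj (d div 4) (d div 4) d) F"
  proof (cases "k = 0")
    case True
    \<comment> \<open>For \<open>d = 0\<close> the left side is a division by zero, hence 0, while
      \<open>sparse\<close> gives sparsity at least 1.\<close>
    then show ?thesis
      using sparse by (simp add: d)
  next
    case False
    \<comment> \<open>The bound \<open>4 ^ n / (2 * n)\<close> on the central binomial coefficient,
      taken at \<open>n = 2 * k\<close>.\<close>
    then have "2 ^ (4 * k) / real (4 * k) \<le> real ((4 * k) choose (2 * k))"
      using central_binomial_lower_bound[of "2 * k"] by (simp add: power_mult)
    then have "2 ^ (4 * k) / real (4 * k) / real ((4 * k) choose k) \<le>
        real ((4 * k) choose (2 * k)) / real ((4 * k) choose k)"
      by (rule divide_right_mono) simp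
    then show ?thesis
      using sparse False by (simp add: d)
  qed
qed

end
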